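(* Let $L$ be the four-component oriented link in $S^3$ that is the untwisted $2$-cable of a Hopf link in which the two cables of each component of the Hopf link have opposite orientations. Then $nt(L) = 2$.
   Context: Links are oriented links in $S^3$, considered up to ambient isotopy, and are represented by oriented diagrams. The link $L$: each of the two components of a Hopf link is replaced by two parallel copies (cables) of itself along its $0$-framing (so the two copies have linking number $0$), and the two copies are given opposite orientations. Labelling the two copies of one Hopf component $a, b$ and the two copies of the other $c, d$ (suitably), the linking numbers are $\mathrm{lk}(a,c) = -1$, $\mathrm{lk}(a,d) = 1$, $\mathrm{lk}(b,c) = 1$, $\mathrm{lk}(b,d) = -1$, $\mathrm{lk}(a,b) = \mathrm{lk}(c,d) = 0$. One-two-way pass-move ($1$-$2$-move): suppose that in some disk of the projection surface an oriented link diagram consists of two disjoint "horizontal" arcs and two disjoint "vertical" arcs, each horizontal arc crossing each vertical arc exactly once (four crossings in total), and that the two arcs of one pair pass over the two arcs of the other pair at all four crossings. Suppose the two arcs of one of the pairs are parallel (run in the same direction) and the two arcs of the other pair are anti-parallel (run in opposite directions); the parallel pair may be either the over-pair or the under-pair. The $1$-$2$-move changes the over/under information of all four crossings, leaving the diagram unchanged elsewhere. For a link $L$ that can be transformed into an unlink by $1$-$2$-moves and Reidemeister moves, the $1$-$2$-move number $nt(L)$ is the minimal number of $1$-$2$-moves in a finite sequence of Reidemeister moves (and planar isotopies) and $1$-$2$-moves transforming a diagram of $L$ into a diagram of an unlink (Reidemeister moves are not counted). *)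

theory Defs
  imports Main "HOL-Library.Extended_Nat"
begin

text \<open>
  Oriented link diagrams in the plane are in Morse position with respect to the height function and
  are read from bottom to top as a sequence of elementary slices, each containing exactly one local
  minimum, local maximum or crossing.  Every diagram can be put in this position by a planar isotopy,
  and planarity is built into the encoding.  A horizontal level between two slices is the list of
  directions, from left to right, in which the strands run through it.
\<close>

datatype dir = Up | Down

fun opp :: "dir \<Rightarrow> dir" where
  "opp Up = Down"
| "opp Down = Up"

text \<open>
  The argument of \<open>Min\<close> and \<open>Max\<close> is the direction of the left leg.
  In \<open>Cross p d e\<close> the strand from bottom left to top right has direction \<open>d\<close>, the strand from bottom
  right to top left has direction \<open>e\<close>, and the former is the over-strand iff \<open>p\<close> holds.
\<close>

datatype event = Min dir | Max dir | Cross bool dir dir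

fun lower :: "event \<Rightarrow> dir list" where
  "lower (Min d) = []"
| "lower (Max d) = [d, opp d]"
| "lower (Cross p d e) = [d, e]"

fun upper :: "event \<Rightarrow> dir list" where
  "upper (Min d) = [d, opp d]"
| "upper (Max d) = []"
| "upper (Cross p d e) = [e, d]"

text \<open>A slice \<open>(l, g, r)\<close> has the vertical strands \<open>l\<close> to the left and \<open>r\<close> to the right of \<open>g\<close>.\<close>

type_synonym slice = "dir list \<times> event \<times> dir list"
type_synonym diagram = "slice list"

fun tangle :: "dir list \<Rightarrow> diagram \<Rightarrow> dir list \<Rightarrow> bool" where
  "tangle s [] t \<longleftrightarrow> s = t"
| "tangle s ((l, g, r) # D) t \<longleftrightarrow> s = l @ lower g @ r \<and> tangle (l @ upper g @ r) D t"

definition link_diagram :: "diagram \<Rightarrow> bool" where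
  "link_diagram D \<longleftrightarrow> tangle [] D []"

fun widen :: "dir list \<Rightarrow> dir list \<Rightarrow> slice \<Rightarrow> slice" where
  "widen l r (l', g, r') = (l @ l', g, r' @ r)"

text \<open>
  A local rule relates two tangles in a disk.  It is applied to a link diagram by replacing a
  consecutive block of slices, the strands outside the disk being vertical at these heights.
\<close>

definition local_change :: "(diagram \<Rightarrow> diagram \<Rightarrow> bool) \<Rightarrow> diagram \<Rightarrow> diagram \<Rightarrow> bool" where
  "local_change R D D' \<longleftrightarrow> link_diagram D \<and> link_diagram D' \<and>
     (\<exists>A B l r u v. R u v \<and> D = A @ map (widen l r) u @ B \<and> D' = A @ map (widen l r) v @ B)"

text \<open>
  The events that occur in a generic planar isotopy of a diagram: two events pass each other in
  height, a minimum and a maximum cancel (or are created), and an extremum passes through a crossing,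
  so that the other strand crosses the second leg instead of the first one.  In the last case the
  over-strand stays the same although it changes its position in \<open>Cross\<close>, hence the negation.
\<close>

inductive planar_rule :: "diagram \<Rightarrow> diagram \<Rightarrow> bool" where
  exchange: "planar_rule [([], g, m @ lower h), (upper g @ m, h, [])]
                         [(lower g @ m, h, []), ([], g, m @ upper h)]"
| zigzag_right: "planar_rule [([d], Min (opp d), []), ([], Max d, [d])] []"
| zigzag_left: "planar_rule [([], Min d, [d]), ([d], Max (opp d), [])] []"
| slide_min: "planar_rule [([d], Min e, []), ([], Cross p d e, [opp e])]
                          [([], Min e, [d]), ([e], Cross (\<not> p) (opp e) d, [])]"
| slide_max: "planar_rule [([e], Cross p d (opp e), []), ([], Max e, [d])]
                          [([], Cross (\<not> p) e d, [opp e]), ([d], Max e, [])]"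

text \<open>
  All orientations and all choices of over-strands are included.  In the third move
  \<open>p\<close>, \<open>q\<close>, \<open>r\<close> say that, in the order at the bottom, the first strand lies above the second, the first above the third
  and the second above the third; the premise excludes the two cyclic configurations.
\<close>

inductive reidemeister_rule :: "diagram \<Rightarrow> diagram \<Rightarrow> bool" where
  R1_right: "reidemeister_rule [([d], Min d, []), ([], Cross p d d, [opp d]), ([d], Max d, [])] []"
| R1_left: "reidemeister_rule
     [([], Min (opp d), [d]), ([opp d], Cross p d d, []), ([], Max (opp d), [d])] []"
| R2: "reidemeister_rule [([], Cross p d e, []), ([], Cross (\<not> p) e d, [])] []"
| R3: "(p = r \<longrightarrow> q = p) \<Longrightarrow> reidemeister_rule
     [([], Cross p d e, [f]), ([e], Cross q d f, []), ([], Cross r e f, [d])]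
     [([d], Cross r e f, []), ([], Cross q d f, [e]), ([f], Cross p d e, [])]"

definition isotopic :: "diagram \<Rightarrow> diagram \<Rightarrow> bool" where
  "isotopic = equivclp (local_change (\<lambda>u v. planar_rule u v \<or> reidemeister_rule u v))"

text \<open>
  Two disjoint strands \<open>a\<close>, \<open>b\<close> running from bottom left to top right across two disjoint strands
  \<open>c\<close>, \<open>d\<close> running from bottom right to top left; \<open>a\<close> and \<open>b\<close> pass over iff \<open>p\<close>.
\<close>

definition grid :: "bool \<Rightarrow> dir \<Rightarrow> dir \<Rightarrow> dir \<Rightarrow> dir \<Rightarrow> diagram" where
  "grid p a b c d =
     [([a], Cross p b c, [d]), ([], Cross p a c, [b, d]), ([c, a], Cross p b d, []),
      ([c], Cross p a d, [b])]"

inductive one_two_rule :: "diagram \<Rightarrow> diagram \<Rightarrow> bool" where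
  "(a = b \<and> c \<noteq> d) \<or> (a \<noteq> b \<and> c = d) \<Longrightarrow> one_two_rule (grid p a b c d) (grid (\<not> p) a b c d)"

abbreviation one_two_move :: "diagram \<Rightarrow> diagram \<Rightarrow> bool" where
  "one_two_move \<equiv> local_change one_two_rule"

inductive one_two_seq :: "nat \<Rightarrow> diagram \<Rightarrow> diagram \<Rightarrow> bool" where
  "isotopic D D' \<Longrightarrow> one_two_seq 0 D D'"
| "one_two_seq n D E \<Longrightarrow> one_two_move E F \<Longrightarrow> isotopic F D' \<Longrightarrow> one_two_seq (Suc n) D D'"

text \<open>A link is represented by the set of all its diagrams.\<close>

definition link_of :: "diagram \<Rightarrow> diagram set" where
  "link_of D = {D'. isotopic D D'}"

fun is_crossing :: "slice \<Rightarrow> bool" where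
  "is_crossing (l, Cross p d e, r) = True"
| "is_crossing (l, g, r) = False"

definition unlink_diagram :: "diagram \<Rightarrow> bool" where
  "unlink_diagram D \<longleftrightarrow> (\<exists>U. link_diagram U \<and> (\<forall>x \<in> set U. \<not> is_crossing x) \<and> isotopic D U)"

text \<open>The value is \<open>\<infinity>\<close> if the link cannot be transformed into an unlink.\<close>

definition nt :: "diagram set \<Rightarrow> enat" where
  "nt L = (INF n \<in> {n. \<exists>D \<in> L. \<exists>U. unlink_diagram U \<and> one_two_seq n D U}. enat n)"

text \<open>
  The blackboard 2-cable whose two copies of each component have opposite orientations.
  The copy that keeps the orientation is put to the left of the strand in its own direction, so on
  an upward as well as on a downward strand the doubled strand reads \<open>[Up, Down]\<close>.
\<close>

definition cable_level :: "dir list \<Rightarrow> dir list" where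
  "cable_level s = concat (map (\<lambda>_. [Up, Down]) s)"

fun cable_event :: "event \<Rightarrow> diagram" where
  "cable_event (Min d) = [([], Min Up, []), ([Up], Min Down, [Down])]"
| "cable_event (Max d) = [([Up], Max Down, [Down]), ([], Max Up, [])]"
| "cable_event (Cross p d e) = grid p Up Down Up Down"

fun cable_slice :: "slice \<Rightarrow> diagram" where
  "cable_slice (l, g, r) = map (widen (cable_level l) (cable_level r)) (cable_event g)"

definition antiparallel_cable :: "diagram \<Rightarrow> diagram" where
  "antiparallel_cable D = concat (map cable_slice D)"

definition hopf_diagram :: diagram where
  "hopf_diagram =
     [([], Min Up, []), ([Up, Down], Min Up, []),
      ([Up], Cross True Down Up, [Down]), ([Up], Cross True Up Down, [Down]),
      ([Up, Down], Max Up, []), ([], Max Up, [])]"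

text \<open>
  No component of \<open>hopf_diagram\<close> crosses itself, so the blackboard framing is the \<open>0\<close>-framing of
  each component and the following is the untwisted cable.
\<close>

definition hopf_cable_diagram :: diagram where
  "hopf_cable_diagram = antiparallel_cable hopf_diagram"

lemma opp_opp [simp]: "opp (opp d) = d"
  by (cases d) simp_all

lemma planar_rule_boundary: "planar_rule u v \<Longrightarrow> \<exists>s t. tangle s u t \<and> tangle s v t"
  by (induction rule: planar_rule.induct) auto

lemma reidemeister_rule_boundary: "reidemeister_rule u v \<Longrightarrow> \<exists>s t. tangle s u t \<and> tangle s v t"
  by (induction rule: reidemeister_rule.induct) auto

lemma one_two_rule_boundary: "one_two_rule u v \<Longrightarrow> \<exists>s t. tangle s u t \<and> tangle s v t"
  by (induction rule: one_two_rule.induct) (auto simp: grid_def)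

lemma link_diagram_hopf: "link_diagram hopf_diagram"
  by (simp add: link_diagram_def hopf_diagram_def)

lemma link_diagram_hopf_cable: "link_diagram hopf_cable_diagram"
  by (simp add: link_diagram_def hopf_cable_diagram_def hopf_diagram_def antiparallel_cable_def
      cable_level_def grid_def)

end

theory Submission
  imports Defs "HOL-Library.Product_Plus"
begin

text \<open>
  The lower bound comes from linking numbers alone.  Suppose that strands \<open>x\<close>, \<open>y\<close> of one pair cross
  strands \<open>u\<close>, \<open>v\<close> of the other, where \<open>x\<close>, \<open>y\<close> are parallel and \<open>u\<close>, \<open>v\<close> antiparallel.  Then \<open>x\<close> and \<open>y\<close>
  meet \<open>u\<close> with one sign and \<open>v\<close> with the other one.  Hence a 1-2-move changes the linking numbers by
  \<open>\<plusminus>(x + y)(u - v)\<close>, read as a quadratic form in the components in which squares are ignored: all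
  positive terms share the factor \<open>u\<close> and all negative terms share \<open>v\<close> (or conversely).  The linking form
  of the cabled Hopf link is \<open>-(a - b)(c - d)\<close>, in which the terms \<open>a c\<close> and \<open>b d\<close> have the same sign and no
  common factor.  Hence some linking number is nonzero after at most one move.

  For this purpose the strands of a diagram are labelled consistently along the components, and each
  crossing contributes its sign times a weight of the two labels.  The set of total weights of all
  labellings is invariant under isotopy (\<open>linking_isotopic\<close>), it is \<open>{0}\<close> for an unlink
  (\<open>linking_unlink\<close>), and its change under a 1-2-move has the form above
  (\<open>linking_one_two_move\<close>).  A weight that only sees the pairs \<open>a c\<close> and \<open>b d\<close> separates the two.

  For the upper bound, two 1-2-moves realize the change of all four crossings between two
  antiparallel pairs (\<open>one_two_seq_antiparallel_grids\<close>).  Put a zigzag into the downward strand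
  of one pair, which then consists of two upward and two downward strands, and sort them so that
  strands of equal direction are adjacent.  Because a tangle that lies entirely over or entirely under
  some strands slides across them (\<open>slide_mpass\<close>), the sorting and its reversal can be put on opposite
  sides of the crossings.  Between them remain one grid with two parallel downward strands and one
  with two parallel upward strands; a 1-2-move is applied to each of them, and the zigzag is removed
  again.  Applied to one of the two cabled crossings of the Hopf diagram, this makes the two cabled
  crossings cancel (\<open>mpass_cancel\<close>), which leaves a diagram without crossings.
\<close>

section \<open>Composition of tangles\<close>

lemma widen_widen: "widen l r (widen l' r' x) = widen (l @ l') (r' @ r) x"
  by (cases x) simp

lemma widen_Nil: "widen [] [] x = x"
  by (cases x) simp

abbreviation beside :: "dir list \<Rightarrow> diagram \<Rightarrow> dir list \<Rightarrow> diagram" where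
  "beside l u r \<equiv> map (widen l r) u"

lemma beside_beside: "beside l (beside l' u r') r = beside (l @ l') u (r' @ r)"
  by (simp add: widen_widen)

lemma beside_Nil: "beside [] u [] = u"
  by (induction u) (auto simp: widen_Nil)

lemma tangle_append: "tangle s (u @ v) t \<longleftrightarrow> (\<exists>m. tangle s u m \<and> tangle m v t)"
  by (induction u arbitrary: s) auto

lemma tangle_beside: "tangle s u t \<Longrightarrow> tangle (l @ s @ r) (beside l u r) (l @ t @ r)"
proof (induction u arbitrary: s)
  case (Cons x u)
  obtain l' g r' where x: "x = (l', g, r')" by (cases x)
  with Cons.prems Cons.IH[of "l' @ upper g @ r'"] show ?case by simp
qed simp

lemma tangle_top_unique: "tangle s u t \<Longrightarrow> tangle s u t' \<Longrightarrow> t = t'"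
  by (induction u arbitrary: s) auto

lemma tangle_bottom_unique: "tangle s u t \<Longrightarrow> tangle s' u t' \<Longrightarrow> u \<noteq> [] \<Longrightarrow> s = s'"
  by (cases u) auto

lemma tangle_beside_inside:
  assumes "tangle m (beside l u r) m'" "u \<noteq> []"
  shows "\<exists>s t. m = l @ s @ r \<and> m' = l @ t @ r \<and> tangle s u t"
proof -
  have "\<exists>t. m' = l @ t @ r \<and> tangle s u t" if "tangle (l @ s @ r) (beside l u r) m'" for s
    using that
  proof (induction u arbitrary: s)
    case (Cons x u)
    obtain l' g r' where x: "x = (l', g, r')" by (cases x)
    with Cons.prems Cons.IH[of "l' @ upper g @ r'"] show ?case by auto
  qed auto
  moreover obtain l' g r' u' where "u = (l', g, r') # u'"
    using assms(2) by (cases u) auto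
  then have "m = l @ (l' @ lower g @ r') @ r"
    using assms(1) by simp
  ultimately show ?thesis
    using assms(1) by blast
qed

abbreviation isotopy_rule :: "diagram \<Rightarrow> diagram \<Rightarrow> bool" where
  "isotopy_rule u v \<equiv> planar_rule u v \<or> reidemeister_rule u v"

text \<open>
  The hypothesis on \<open>R\<close> pins down the levels at which the disk is inserted: a nonempty block of
  slices determines its bottom level, whereas an empty one would fit everywhere.
\<close>
lemma local_change_decompose:
  assumes "local_change R D D'"
    and R: "\<And>u v. R u v \<Longrightarrow> u \<noteq> [] \<and> (\<exists>s t. tangle s u t \<and> tangle s v t)"
  obtains A B l r u v s t where "R u v" "D = A @ beside l u r @ B" "D' = A @ beside l v r @ B"
    "tangle [] A (l @ s @ r)" "tangle s u t" "tangle s v t" "tangle (l @ t @ r) B []"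
proof -
  obtain A B l r u v where uv: "R u v" and D: "D = A @ beside l u r @ B" and D': "D' = A @ beside l v r @ B"
    and "tangle [] (A @ beside l u r @ B) []"
    using assms(1) unfolding local_change_def link_diagram_def by blast
  then obtain m m' where m: "tangle [] A m" "tangle m (beside l u r) m'" "tangle m' B []"
    by (auto simp: tangle_append)
  obtain s t where st: "m = l @ s @ r" "m' = l @ t @ r" "tangle s u t"
    using tangle_beside_inside[OF m(2)] R[OF uv] by blast
  moreover have "tangle s v t"
    using R[OF uv] st(3) tangle_bottom_unique tangle_top_unique by blast
  ultimately show ?thesis
    using that uv D D' m by blast
qed

lemma isotopy_rule_boundary:
  assumes "isotopy_rule u v"
  shows "u \<noteq> [] \<and> (\<exists>s t. tangle s u t \<and> tangle s v t)"
proof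
  show "u \<noteq> []"
    using assms
  proof
    assume "planar_rule u v"
    then show ?thesis by cases simp_all
  next
    assume "reidemeister_rule u v"
    then show ?thesis by cases simp_all
  qed
  show "\<exists>s t. tangle s u t \<and> tangle s v t"
    using assms planar_rule_boundary reidemeister_rule_boundary by blast
qed

lemma local_changeI:
  "R u v \<Longrightarrow> link_diagram (A @ beside l u r @ B) \<Longrightarrow> link_diagram (A @ beside l v r @ B) \<Longrightarrow>
    local_change R (A @ beside l u r @ B) (A @ beside l v r @ B)"
  unfolding local_change_def by blast

lemma link_diagram_plug:
  assumes "tangle [] A (l @ s @ r)" "tangle s u t" "tangle (l @ t @ r) B []"
  shows "link_diagram (A @ beside l u r @ B)"
  using assms tangle_beside unfolding link_diagram_def tangle_append by blast

lemma isotopic_refl: "isotopic D D"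
  by (simp add: isotopic_def)

lemma isotopic_sym: "isotopic D E \<Longrightarrow> isotopic E D"
  unfolding isotopic_def by (rule equivclp_sym)

lemma isotopic_trans: "isotopic D E \<Longrightarrow> isotopic E F \<Longrightarrow> isotopic D F"
  unfolding isotopic_def by (rule equivclp_trans)

section \<open>Isotopy of tangles\<close>

text \<open>
  Isotopy is only given for closed diagrams.  For tangles it is defined by what happens to the
  closed diagrams around them, which makes it a congruence for stacking and for juxtaposition.  The
  levels \<open>s\<close> and \<open>t\<close> are recorded because an empty tangle does not determine them.
\<close>
definition deform :: "dir list \<Rightarrow> diagram \<Rightarrow> diagram \<Rightarrow> dir list \<Rightarrow> bool" where
  "deform s u v t \<longleftrightarrow> tangle s u t \<and> tangle s v t \<and>
     (\<forall>A B l r. tangle [] A (l @ s @ r) \<longrightarrow> tangle (l @ t @ r) B [] \<longrightarrow>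
        isotopic (A @ beside l u r @ B) (A @ beside l v r @ B))"

lemma deform_plug:
  assumes "deform s u v t" "tangle [] A (l @ s @ r)" "tangle (l @ t @ r) B []"
  shows "isotopic (A @ beside l u r @ B) (A @ beside l v r @ B)"
  using assms unfolding deform_def by blast

lemma deform_refl: "tangle s u t \<Longrightarrow> deform s u u t"
  by (simp add: deform_def isotopic_refl)

lemma deform_sym: "deform s u v t \<Longrightarrow> deform s v u t"
  by (auto simp: deform_def intro: isotopic_sym)

lemma deform_trans [trans]: "deform s u v t \<Longrightarrow> deform s v w t \<Longrightarrow> deform s u w t"
  unfolding deform_def by (blast intro: isotopic_trans)

lemma deform_rule:
  assumes "isotopy_rule u v" "tangle s u t" "tangle s v t"
  shows "deform s u v t"
proof -
  have "isotopic (A @ beside l u r @ B) (A @ beside l v r @ B)"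
    if "tangle [] A (l @ s @ r)" "tangle (l @ t @ r) B []" for A B l r
  proof -
    have "local_change isotopy_rule (A @ beside l u r @ B) (A @ beside l v r @ B)"
      using assms that by (intro local_changeI link_diagram_plug)
    then show ?thesis
      unfolding isotopic_def by (rule r_into_equivclp)
  qed
  then show ?thesis
    using assms by (simp add: deform_def)
qed

lemma deform_append:
  assumes "deform s u u' m" "deform m v v' t"
  shows "deform s (u @ v) (u' @ v') t"
proof -
  have "isotopic (A @ beside l (u @ v) r @ B) (A @ beside l (u' @ v') r @ B)"
    if AB: "tangle [] A (l @ s @ r)" "tangle (l @ t @ r) B []" for A B l r
  proof -
    have "tangle (l @ m @ r) (beside l v r @ B) []"
      using AB assms by (auto simp: deform_def tangle_append intro: tangle_beside)
    then have "isotopic (A @ beside l u r @ (beside l v r @ B)) (A @ beside l u' r @ (beside l v r @ B))"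
      using AB assms unfolding deform_def by blast
    moreover have "tangle [] (A @ beside l u' r) (l @ m @ r)"
      using AB assms by (auto simp: deform_def tangle_append intro: tangle_beside)
    then have "isotopic ((A @ beside l u' r) @ beside l v r @ B) ((A @ beside l u' r) @ beside l v' r @ B)"
      using AB assms unfolding deform_def by blast
    ultimately show ?thesis
      by (auto intro: isotopic_trans)
  qed
  then show ?thesis
    using assms by (auto simp: deform_def tangle_append)
qed

lemma deform_beside:
  assumes "deform s u v t"
  shows "deform (l @ s @ r) (beside l u r) (beside l v r) (l @ t @ r)"
proof -
  have "isotopic (A @ beside l' (beside l u r) r' @ B) (A @ beside l' (beside l v r) r' @ B)"
    if "tangle [] A (l' @ (l @ s @ r) @ r')" "tangle (l' @ (l @ t @ r) @ r') B []" for A B l' r'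
    using that assms unfolding deform_def beside_beside by simp
  then show ?thesis
    using assms tangle_beside unfolding deform_def by blast
qed

lemma deform_in_context:
  assumes "deform m v v' m'" "tangle s u m" "tangle m' w t"
  shows "deform s (u @ v @ w) (u @ v' @ w) t"
  by (rule deform_append[OF deform_refl deform_append[OF _ deform_refl]]) (rule assms)+

lemmas deform_below = deform_append[OF _ deform_refl]
lemmas deform_above = deform_append[OF deform_refl]

lemma exchange_slices:
  "deform (l @ lower g @ r @ l' @ lower h @ r')
     [(l, g, r @ l' @ lower h @ r'), (l @ upper g @ r @ l', h, r')]
     [(l @ lower g @ r @ l', h, r'), (l, g, r @ l' @ upper h @ r')]
     (l @ upper g @ r @ l' @ upper h @ r')"
proof -
  have "deform (lower g @ (r @ l') @ lower h)
     [([], g, (r @ l') @ lower h), (upper g @ (r @ l'), h, [])]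
     [(lower g @ (r @ l'), h, []), ([], g, (r @ l') @ upper h)]
     (upper g @ (r @ l') @ upper h)"
    by (rule deform_rule[OF disjI1[OF planar_rule.exchange]]) simp_all
  from deform_beside[OF this, of l r'] show ?thesis by simp
qed

lemma exchange_slice:
  assumes "tangle s' v t'"
  shows "deform ((l @ lower g @ r) @ s')
     ((l, g, r @ s') # beside (l @ upper g @ r) v [])
     (beside (l @ lower g @ r) v [] @ [(l, g, r @ t')])
     ((l @ upper g @ r) @ t')"
  using assms
proof (induction v arbitrary: s')
  case Nil
  then show ?case by (auto intro!: deform_refl)
next
  case (Cons x v)
  obtain l' h r' where x: "x = (l', h, r')" by (cases x)
  with Cons.prems have s': "s' = l' @ lower h @ r'" and v: "tangle (l' @ upper h @ r') v t'"
    by auto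
  have "tangle (l @ upper g @ r @ l' @ upper h @ r') (beside (l @ upper g @ r) v [])
      (l @ upper g @ r @ t')"
    using tangle_beside[OF v, of "l @ upper g @ r" "[]"] by simp
  from deform_below[OF exchange_slices this]
  have "deform ((l @ lower g @ r) @ s')
     ((l, g, r @ s') # (l @ upper g @ r @ l', h, r') # beside (l @ upper g @ r) v [])
     ((l @ lower g @ r @ l', h, r') # (l, g, r @ l' @ upper h @ r') # beside (l @ upper g @ r) v [])
     ((l @ upper g @ r) @ t')"
    by (simp add: s')
  also have "deform ((l @ lower g @ r) @ s')
     ((l @ lower g @ r @ l', h, r') # (l, g, r @ l' @ upper h @ r') # beside (l @ upper g @ r) v [])
     ((l @ lower g @ r @ l', h, r') # beside (l @ lower g @ r) v [] @ [(l, g, r @ t')])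
     ((l @ upper g @ r) @ t')"
    using deform_above[OF _ Cons.IH[OF v], of _ "[(l @ lower g @ r @ l', h, r')]"] by (simp add: s')
  finally show ?case by (simp add: x)
qed

text \<open>
  Tangles side by side can be stacked in either order, since any two of their slices pass each
  other in height.
\<close>
lemma exchange_tangles:
  assumes "tangle s u t" "tangle s' v t'"
  shows "deform (s @ s') (beside [] u s' @ beside t v []) (beside s v [] @ beside [] u t') (t @ t')"
  using assms(1)
proof (induction u arbitrary: s)
  case Nil
  then show ?case using tangle_beside[OF assms(2), of t "[]"] by (auto intro!: deform_refl)
next
  case (Cons x u)
  obtain l g r where x: "x = (l, g, r)" by (cases x)
  with Cons.prems have s: "s = l @ lower g @ r" and u: "tangle (l @ upper g @ r) u t"
    by auto
  have "deform (s @ s') ((l, g, r @ s') # beside [] u s' @ beside t v [])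
      ((l, g, r @ s') # beside (l @ upper g @ r) v [] @ beside [] u t') (t @ t')"
    using deform_above[OF _ Cons.IH[OF u], of _ "[(l, g, r @ s')]"] by (simp add: s)
  also have "tangle ((l @ upper g @ r) @ t') (beside [] u t') (t @ t')"
    using tangle_beside[OF u, of "[]"] by simp
  from deform_below[OF exchange_slice[OF assms(2)] this]
  have "deform (s @ s') ((l, g, r @ s') # beside (l @ upper g @ r) v [] @ beside [] u t')
      (beside s v [] @ (l, g, r @ t') # beside [] u t') (t @ t')"
    by (simp add: s)
  finally show ?case by (simp add: x)
qed

section \<open>Sliding strands across tangles\<close>

text \<open>
  A strand of direction \<open>e\<close> runs from the right of the strands \<open>s\<close> to their left, under all of them
  if \<open>p\<close> holds and over all of them otherwise.
\<close>
fun pass :: "bool \<Rightarrow> dir list \<Rightarrow> dir \<Rightarrow> diagram" where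
  "pass p [] e = []"
| "pass p (x # s) e = beside [x] (pass p s e) [] @ [([], Cross p x e, s)]"

text \<open>
  The strands \<open>s\<close>, in the left half at the bottom, change places with the strands \<open>t\<close> in the right
  half; all of \<open>s\<close> pass over all of \<open>t\<close> iff \<open>p\<close> holds.
\<close>
fun mpass :: "bool \<Rightarrow> dir list \<Rightarrow> dir list \<Rightarrow> diagram" where
  "mpass p s [] = []"
| "mpass p s (e # t) = beside [] (pass p s e) t @ beside [e] (mpass p s t) []"

lemma grid_eq_mpass: "grid p a b c d = mpass p [a, b] [c, d]"
  by (simp add: grid_def)

lemma tangle_pass: "tangle (s @ [e]) (pass p s e) (e # s)"
proof (induction s)
  case (Cons x s)
  from tangle_beside[OF Cons.IH, of "[x]" "[]"] show ?case by (auto simp: tangle_append)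
qed simp

lemma tangle_mpass: "tangle (s @ t) (mpass p s t) (t @ s)"
proof (induction t)
  case (Cons e t)
  from tangle_beside[OF Cons.IH, of "[e]" "[]"] tangle_beside[OF tangle_pass, of "[]" s e t p]
  show ?case by (auto simp: tangle_append)
qed simp

lemma pass_append: "pass p (s @ s') e = beside s (pass p s' e) [] @ beside [] (pass p s e) s'"
  by (induction s) (simp_all add: widen_widen beside_Nil)

lemma deform_R2: "deform [d, e] [([], Cross p d e, []), ([], Cross (\<not> p) e d, [])] [] [d, e]"
  by (rule deform_rule) (auto intro: reidemeister_rule.R2)

text \<open>
  An extremum passes the strand by one planar slide, which moves one of the two crossings to the
  other leg, where it cancels with the second crossing.  For a crossing this is the third
  Reidemeister move, and the cyclic configurations do not occur since the strand lies on the same side of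
  both strands of the crossing.
\<close>
lemma slide_event:
  "deform (lower g @ [e]) (([], g, [e]) # pass p (upper g) e) (pass p (lower g) e @ [([e], g, [])])
     (e # upper g)"
proof (cases g)
  case (Min x)
  have 1: "deform [e] [([], Min x, [e]), ([x], Cross p (opp x) e, [])]
     [([e], Min x, []), ([], Cross (\<not> p) e x, [opp x])] [x, e, opp x]"
    by (rule deform_sym, rule deform_rule) (use planar_rule.slide_min[of e x "\<not> p"] in auto)
  from deform_below[OF 1]
  have "deform [e] [([], Min x, [e]), ([x], Cross p (opp x) e, []), ([], Cross p x e, [opp x])]
     [([e], Min x, []), ([], Cross (\<not> p) e x, [opp x]), ([], Cross p x e, [opp x])] [e, x, opp x]"
    by simp
  also from deform_above[OF _ deform_beside[OF deform_R2[of e x "\<not> p"], of "[]" "[opp x]"],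
      of _ "[([e], Min x, [])]"]
  have "deform [e] [([e], Min x, []), ([], Cross (\<not> p) e x, [opp x]), ([], Cross p x e, [opp x])]
     [([e], Min x, [])] [e, x, opp x]"
    by simp
  finally show ?thesis by (simp add: Min)
next
  case (Max x)
  have 1: "deform [x, e, opp x] [([x], Cross (\<not> p) e (opp x), []), ([], Max x, [e])]
     [([], Cross p x e, [opp x]), ([e], Max x, [])] [e]"
    by (rule deform_rule) (use planar_rule.slide_max[of x "\<not> p" e] in auto)
  from deform_above[OF _ deform_sym[OF 1], of _ "[([x], Cross p (opp x) e, [])]"]
  have "deform [x, opp x, e] [([x], Cross p (opp x) e, []), ([], Cross p x e, [opp x]), ([e], Max x, [])]
     [([x], Cross p (opp x) e, []), ([x], Cross (\<not> p) e (opp x), []), ([], Max x, [e])] [e]"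
    by simp
  also from deform_below[OF deform_beside[OF deform_R2[of "opp x" e p], of "[x]" "[]"]]
  have "deform [x, opp x, e]
     [([x], Cross p (opp x) e, []), ([x], Cross (\<not> p) e (opp x), []), ([], Max x, [e])]
     [([], Max x, [e])] [e]"
    by simp
  finally show ?thesis by (simp add: Max deform_sym)
next
  case (Cross q x y)
  show ?thesis
    unfolding Cross by (rule deform_rule) (use reidemeister_rule.R3[of q p p] in auto)
qed

text \<open>
  The strand first crosses the strands on the right of the event, then the event itself, then the
  strands on its left; in the first and the last phase the event is out of the way and only
  changes its height.
\<close>
lemma slide_slice:
  "deform (l @ lower g @ r @ [e]) ((l, g, r @ [e]) # pass p (l @ upper g @ r) e)
     (pass p (l @ lower g @ r) e @ [(e # l, g, r)]) (e # l @ upper g @ r)"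
proof -
  let ?R = "\<lambda>c. beside (l @ c) (pass p r e) []"
  let ?G = "\<lambda>c. beside l (pass p c e) r"
  let ?L = "\<lambda>c. beside [] (pass p l e) (c @ r)"
  have split: "pass p (l @ c @ r) e = ?R c @ ?G c @ ?L c" for c
    by (simp add: pass_append beside_beside[of _ "[]"] beside_beside del: map_map)
  have R: "tangle (l @ c @ r @ [e]) (?R c) (l @ c @ e # r)" for c
    using tangle_beside[OF tangle_pass, of "l @ c" r e "[]"] by simp
  have L: "tangle (l @ e # c @ r) (?L c) (e # l @ c @ r)" for c
    using tangle_beside[OF tangle_pass, of "[]" l e "c @ r"] by simp
  have G: "tangle (l @ c @ e # r) (?G c) (l @ e # c @ r)" for c
    using tangle_beside[OF tangle_pass, of l c e r] by simp
  have 1: "deform (l @ lower g @ r @ [e]) ((l, g, r @ [e]) # ?R (upper g))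
      (?R (lower g) @ [(l, g, e # r)]) (l @ upper g @ e # r)"
    using exchange_slice[OF tangle_pass, of l g "[]" r e p] by simp
  have 2: "deform (l @ lower g @ e # r) ((l, g, e # r) # ?G (upper g))
      (?G (lower g) @ [(l @ [e], g, r)]) (l @ e # upper g @ r)"
    using deform_beside[OF slide_event, of l g e r p] by simp
  have "tangle (lower g @ r) [([], g, r)] (upper g @ r)" by simp
  from deform_sym[OF exchange_tangles[OF tangle_pass this, of l e p]]
  have 3: "deform (l @ e # lower g @ r) ((l @ [e], g, r) # ?L (upper g)) (?L (lower g) @ [(e # l, g, r)])
        (e # l @ upper g @ r)"
    by simp
  have "tangle (l @ upper g @ e # r) (?G (upper g) @ ?L (upper g)) (e # l @ upper g @ r)"
    using G L unfolding tangle_append by blast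
  from deform_below[OF 1 this]
  have "deform (l @ lower g @ r @ [e]) ((l, g, r @ [e]) # ?R (upper g) @ ?G (upper g) @ ?L (upper g))
     (?R (lower g) @ (l, g, e # r) # ?G (upper g) @ ?L (upper g)) (e # l @ upper g @ r)"
    by simp
  also from deform_in_context[OF 2 R L]
  have "deform (l @ lower g @ r @ [e]) (?R (lower g) @ (l, g, e # r) # ?G (upper g) @ ?L (upper g))
     (?R (lower g) @ ?G (lower g) @ (l @ [e], g, r) # ?L (upper g)) (e # l @ upper g @ r)"
    by simp
  also from deform_above[OF R deform_above[OF G 3]]
  have "deform (l @ lower g @ r @ [e]) (?R (lower g) @ ?G (lower g) @ (l @ [e], g, r) # ?L (upper g))
     (?R (lower g) @ ?G (lower g) @ ?L (lower g) @ [(e # l, g, r)]) (e # l @ upper g @ r)" .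
  finally show ?thesis
    by (simp add: split)
qed

lemma slide_pass:
  assumes "tangle s u t"
  shows "deform (s @ [e]) (beside [] u [e] @ pass p t e) (pass p s e @ beside [e] u []) (e # t)"
  using assms
proof (induction u arbitrary: s)
  case Nil
  then show ?case using tangle_pass by (auto intro: deform_refl)
next
  case (Cons x u)
  obtain l g r where x: "x = (l, g, r)" by (cases x)
  with Cons.prems have s: "s = l @ lower g @ r" and u: "tangle (l @ upper g @ r) u t"
    by auto
  have "deform (s @ [e]) ((l, g, r @ [e]) # beside [] u [e] @ pass p t e)
     ((l, g, r @ [e]) # pass p (l @ upper g @ r) e @ beside [e] u []) (e # t)"
    using deform_above[OF _ Cons.IH[OF u], of _ "[(l, g, r @ [e])]"] by (simp add: s)
  also have "tangle (e # l @ upper g @ r) (beside [e] u []) (e # t)"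
    using tangle_beside[OF u, of "[e]" "[]"] by simp
  from deform_below[OF slide_slice this]
  have "deform (s @ [e]) ((l, g, r @ [e]) # pass p (l @ upper g @ r) e @ beside [e] u [])
     (pass p s e @ (e # l, g, r) # beside [e] u []) (e # t)"
    by (simp add: s)
  finally show ?case by (simp add: x)
qed

text \<open>
  A tangle that lies entirely over, or entirely under, a family of strands can be moved from one
  side of the family to the other.
\<close>
lemma slide_mpass:
  assumes "tangle s u t"
  shows "deform (s @ q) (beside [] u q @ mpass p t q) (mpass p s q @ beside q u []) (q @ t)"
proof (induction q)
  case Nil
  then show ?case using assms by (simp add: beside_Nil deform_refl)
next
  case (Cons e q)
  have "tangle (e # t @ q) (beside [e] (mpass p t q) []) (e # q @ t)"
    using tangle_beside[OF tangle_mpass, of "[e]" t q "[]"] by simp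
  from deform_below[OF deform_beside[OF slide_pass[OF assms, of e p], of "[]" q, simplified] this]
  have "deform (s @ e # q)
     (beside [] u (e # q) @ beside [] (pass p t e) q @ beside [e] (mpass p t q) [])
     (beside [] (pass p s e) q @ beside [e] u q @ beside [e] (mpass p t q) []) (e # q @ t)"
    by (simp add: widen_widen o_def)
  also have "tangle (s @ e # q) (beside [] (pass p s e) q) (e # s @ q)"
    using tangle_beside[OF tangle_pass, of "[]" s e q p] by simp
  from deform_above[OF this] deform_beside[OF Cons.IH, of "[e]" "[]"]
  have "deform (s @ e # q)
     (beside [] (pass p s e) q @ beside [e] u q @ beside [e] (mpass p t q) [])
     (beside [] (pass p s e) q @ beside [e] (mpass p s q) [] @ beside (e # q) u []) (e # q @ t)"
    by (simp add: widen_widen o_def)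
  finally show ?case
    by simp
qed

text \<open>
  \<open>mpass\<close> is built strand by strand from its second family; splitting the first family instead
  needs a reordering of distant crossings.
\<close>
lemma mpass_append:
  "deform (s @ s' @ t) (mpass p (s @ s') t) (beside s (mpass p s' t) [] @ beside [] (mpass p s t) s') (t @ s @ s')"
proof (induction t)
  case Nil
  then show ?case by (simp add: deform_refl)
next
  case (Cons e t)
  let ?A = "beside s (pass p s' e) t" and ?B = "beside [] (pass p s e) (s' @ t)"
  let ?B' = "beside [] (pass p s e) (t @ s')" and ?C' = "beside (s @ [e]) (mpass p s' t) []"
  let ?C = "beside (e # s) (mpass p s' t) []" and ?D = "beside [e] (mpass p s t) s'"
  have A: "tangle (s @ s' @ e # t) ?A (s @ e # s' @ t)"
    using tangle_beside[OF tangle_pass, of s s' e t] by simp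
  have B: "tangle (s @ e # s' @ t) ?B (e # s @ s' @ t)"
    using tangle_beside[OF tangle_pass, of "[]" s e "s' @ t"] by simp
  have D: "tangle (e # s @ t @ s') ?D (e # t @ s @ s')"
    using tangle_beside[OF tangle_mpass, of "[e]" s t s'] by simp
  from deform_above[OF A deform_above[OF B]] deform_beside[OF Cons.IH, of "[e]" "[]"]
  have "deform (s @ s' @ e # t) (?A @ ?B @ beside [e] (mpass p (s @ s') t) [])
    (?A @ ?B @ ?C @ ?D) (e # t @ s @ s')"
    by (simp add: widen_widen o_def)
  also from deform_in_context[OF exchange_tangles[OF tangle_pass[of s e p] tangle_mpass[of s' t p], simplified] A D]
  have "deform (s @ s' @ e # t) (?A @ ?B @ ?C @ ?D) (?A @ ?C' @ ?B' @ ?D) (e # t @ s @ s')"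
    by simp
  finally show ?case
    by (simp add: widen_widen o_def pass_append)
qed

lemma mpass_single_cancel:
  "deform (x # t) (mpass p [x] t @ pass (\<not> p) t x) [] (x # t)"
proof (induction t)
  case Nil
  then show ?case by (simp add: deform_refl)
next
  case (Cons y t)
  have "deform (x # y # t)
     (([], Cross p x y, t) # beside [y] (mpass p [x] t @ pass (\<not> p) t x) [] @ [([], Cross (\<not> p) y x, t)])
     [([], Cross p x y, t), ([], Cross (\<not> p) y x, t)] (x # y # t)"
    using deform_in_context[OF deform_beside[OF Cons.IH, of "[y]" "[]"],
        of _ "[([], Cross p x y, t)]" "[([], Cross (\<not> p) y x, t)]"] by simp
  also have "deform (x # y # t) [([], Cross p x y, t), ([], Cross (\<not> p) y x, t)] [] (x # y # t)"
    using deform_beside[OF deform_R2[of x y p], of "[]" t] by simp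
  finally show ?case by simp
qed

text \<open>
  Up to the order of distant crossings, the second block is the first one read backwards with \<open>s\<close>
  still on the same side of \<open>t\<close>, so that second Reidemeister moves remove all crossings from the middle
  outwards.
\<close>
lemma mpass_cancel: "deform (s @ t) (mpass p s t @ mpass (\<not> p) t s) [] (s @ t)"
proof (induction s)
  case Nil
  have "mpass q [] t = []" for q by (induction t) auto
  then show ?case by (simp add: deform_refl)
next
  case (Cons x s)
  let ?A = "beside [x] (mpass p s t) []" and ?Z = "beside [x] (mpass (\<not> p) t s) []"
  let ?X = "beside [] (mpass p [x] t) s"
  have A: "tangle (x # s @ t) ?A (x # t @ s)"
    using tangle_beside[OF tangle_mpass, of "[x]" s t "[]"] by simp
  have Z: "tangle (x # t @ s) ?Z (x # s @ t)"
    using tangle_beside[OF tangle_mpass, of "[x]" t s "[]"] by simp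
  have "deform (x # s @ t) (mpass p (x # s) t) (?A @ ?X) (t @ x # s)"
    using mpass_append[of "[x]" s t p] by simp
  from deform_below[OF this] tangle_mpass[of t "x # s" "\<not> p"]
  have "deform (x # s @ t) (mpass p (x # s) t @ mpass (\<not> p) t (x # s))
     (?A @ ?X @ mpass (\<not> p) t (x # s)) (x # s @ t)"
    by simp
  also from deform_in_context[OF deform_beside[OF mpass_single_cancel[of x t p], of "[]" s, simplified] A Z]
  have "deform (x # s @ t) (?A @ ?X @ mpass (\<not> p) t (x # s)) (?A @ ?Z) (x # s @ t)"
    by simp
  also have "deform (x # s @ t) (?A @ ?Z) [] (x # s @ t)"
    using deform_beside[OF Cons.IH, of "[x]" "[]"] by simp
  finally show ?case by simp
qed

section \<open>Two moves suffice\<close>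

text \<open>
  A zigzag turns the downward strand into three strands \<open>Down\<close>, \<open>Up\<close>, \<open>Down\<close>; a crossing of the
  first two of them sorts the strands by direction.
\<close>
definition regroup :: diagram where
  "regroup = [([Up, Down], Min Up, []), ([Up], Cross True Down Up, [Down])]"

definition ungroup :: diagram where
  "ungroup = [([Up], Cross False Up Down, [Down]), ([Up], Max Down, [Down])]"

lemma tangle_regroup: "tangle [Up, Down] regroup [Up, Up, Down, Down]"
  and tangle_ungroup: "tangle [Up, Up, Down, Down] ungroup [Up, Down]"
  by (simp_all add: regroup_def ungroup_def)

lemma regroup_ungroup: "deform [Up, Down] (regroup @ ungroup) [] [Up, Down]"
proof -
  have "deform [Up, Down] (regroup @ ungroup)
     [([Up, Down], Min Up, []), ([Up], Max Down, [Down])] [Up, Down]"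
    using deform_in_context[OF deform_beside[OF deform_R2[of Down Up True], of "[Up]" "[Down]"],
        of _ "[([Up, Down], Min Up, [])]" "[([Up], Max Down, [Down])]"]
    by (simp add: regroup_def ungroup_def)
  also have "deform [Down] [([Down], Min Up, []), ([], Max Down, [Down])] [] [Down]"
    by (rule deform_rule) (use planar_rule.zigzag_right[of Down] in auto)
  from deform_beside[OF this, of "[Up]" "[]"]
  have "deform [Up, Down] [([Up, Down], Min Up, []), ([Up], Max Down, [Down])] [] [Up, Down]"
    by simp
  finally show ?thesis .
qed

text \<open>
  The crossings of an antiparallel pair with \<open>t\<close> after the zigzag has been stretched across \<open>t\<close>.
  The flags \<open>p\<close> and \<open>q\<close> of the two sorted pairs are independent: a 1-2-move on one pair changes one
  of them.
\<close>
definition regrouped_mpass :: "bool \<Rightarrow> bool \<Rightarrow> dir list \<Rightarrow> diagram" where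
  "regrouped_mpass p q t = beside [] regroup t @ beside [Up, Up] (mpass p [Down, Down] t) [] @
     beside [] (mpass q [Up, Up] t) [Down, Down] @ beside t ungroup []"

lemma mpass_deform_regrouped:
  "deform ([Up, Down] @ t) (mpass p [Up, Down] t) (regrouped_mpass p p t) (t @ [Up, Down])"
proof -
  have R: "tangle ([Up, Down] @ t) (beside [] regroup t) ([Up, Up, Down, Down] @ t)"
    using tangle_beside[OF tangle_regroup, of "[]"] by simp
  have U: "tangle (t @ [Up, Up, Down, Down]) (beside t ungroup []) (t @ [Up, Down])"
    using tangle_beside[OF tangle_ungroup, of _ "[]"] by simp
  have "deform ([Up, Down] @ t) [] (beside [] (regroup @ ungroup) t) ([Up, Down] @ t)"
    using deform_beside[OF deform_sym[OF regroup_ungroup], of "[]"] by simp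
  from deform_below[OF this tangle_mpass, of p]
  have "deform ([Up, Down] @ t) (mpass p [Up, Down] t)
     (beside [] regroup t @ beside [] ungroup t @ mpass p [Up, Down] t) (t @ [Up, Down])"
    by simp
  also note deform_above[OF R slide_mpass[OF tangle_ungroup, of t p]]
  also have "deform ([Up, Up, Down, Down] @ t) (mpass p [Up, Up, Down, Down] t)
      (beside [Up, Up] (mpass p [Down, Down] t) [] @ beside [] (mpass p [Up, Up] t) [Down, Down])
      (t @ [Up, Up, Down, Down])"
    using mpass_append[of "[Up, Up]" "[Down, Down]" t p] by simp
  from deform_in_context[OF this R U]
  have "deform ([Up, Down] @ t)
     (beside [] regroup t @ mpass p [Up, Up, Down, Down] t @ beside t ungroup [])
     (regrouped_mpass p p t) (t @ [Up, Down])"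
    by (simp add: regrouped_mpass_def)
  finally show ?thesis .
qed

text \<open>
  Since the pair \<open>c\<close>, \<open>d\<close> is antiparallel, both grids in \<open>regrouped_mpass\<close> admit a 1-2-move.  After
  both moves the flags agree again and the zigzag can be taken back.
\<close>
lemma one_two_seq_antiparallel_grids:
  assumes A: "tangle [] A (l @ [Up, Down, c, d] @ r)" and B: "tangle (l @ [c, d, Up, Down] @ r) B []"
    and "c \<noteq> d"
  shows "one_two_seq 2 (A @ beside l (grid p Up Down c d) r @ B)
     (A @ beside l (grid (\<not> p) Up Down c d) r @ B)"
proof -
  let ?G = "\<lambda>p. A @ beside l (grid p Up Down c d) r @ B"
  let ?X = "\<lambda>p q. A @ beside l (regrouped_mpass p q [c, d]) r @ B"
  have "tangle [Up, Down, c, d] (regrouped_mpass p q [c, d]) [c, d, Up, Down]" for p q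
    by (simp add: regrouped_mpass_def regroup_def ungroup_def)
  from link_diagram_plug[OF A this B] have link: "link_diagram (?X p q)" for p q .
  have iso: "isotopic (?G p) (?X p p)" for p
    using deform_plug[OF mpass_deform_regrouped[of "[c, d]" p], of A l r B] A B
    by (simp add: grid_eq_mpass)
  have rule: "one_two_rule (grid p e e c d) (grid (\<not> p) e e c d)" for e p
    by (rule one_two_rule.intros) (use \<open>c \<noteq> d\<close> in auto)
  have X1: "?X p' p = (A @ beside l (beside [] regroup [c, d]) r) @
      beside (l @ [Up, Up]) (grid p' Down Down c d) r @
      beside l (beside [] (grid p Up Up c d) [Down, Down] @ beside [c, d] ungroup []) r @ B" for p'
    by (simp add: regrouped_mpass_def grid_eq_mpass)
  have 1: "one_two_move (?X p p) (?X (\<not> p) p)"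
    unfolding X1 by (rule local_changeI, rule rule) (fold X1, rule link, rule link)
  have X2: "?X (\<not> p) p' = (A @ beside l (beside [] regroup [c, d] @
        beside [Up, Up] (grid (\<not> p) Down Down c d) []) r) @
      beside l (grid p' Up Up c d) ([Down, Down] @ r) @ beside (l @ [c, d]) ungroup r @ B" for p'
    by (simp add: regrouped_mpass_def grid_eq_mpass widen_widen)
  have 2: "one_two_move (?X (\<not> p) p) (?X (\<not> p) (\<not> p))"
    unfolding X2 by (rule local_changeI, rule rule) (fold X2, rule link, rule link)
  have "one_two_seq 0 (?G p) (?X p p)"
    by (rule one_two_seq.intros(1)[OF iso])
  then have "one_two_seq (Suc 0) (?G p) (?X (\<not> p) p)"
    by (rule one_two_seq.intros(2)[OF _ 1 isotopic_refl])
  then have "one_two_seq (Suc (Suc 0)) (?G p) (?G (\<not> p))"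
    by (rule one_two_seq.intros(2)[OF _ 2 isotopic_sym[OF iso]])
  then show ?thesis
    by (simp only: numeral_2_eq_2)
qed

text \<open>
  The two crossings of the Hopf diagram become two copies of the same grid.  Once the upper copy has
  been changed it is inverse to the lower one.
\<close>
lemma hopf_cable_two_moves: "\<exists>U. unlink_diagram U \<and> one_two_seq 2 hopf_cable_diagram U"
proof -
  let ?l = "[Up, Down]" and ?t = "[Up, Down, Up, Down]"
  define A where "A = cable_slice ([], Min Up, []) @ cable_slice ([Up, Down], Min Up, [])"
  define B where "B = cable_slice ([Up, Down], Max Up, []) @ cable_slice ([], Max Up, [])"
  define G where "G p = beside ?l (grid p Up Down Up Down) ?l" for p
  have A: "tangle [] A (?l @ ?t @ ?l)"
    by (simp add: A_def cable_level_def)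
  have B: "tangle (?l @ ?t @ ?l) B []"
    by (simp add: B_def cable_level_def)
  have G: "tangle (?l @ ?t @ ?l) (G p) (?l @ ?t @ ?l)" for p
    by (simp add: G_def grid_def)
  have AG: "tangle [] (A @ G True) (?l @ ?t @ ?l)"
    using A G unfolding tangle_append by blast
  have "one_two_seq 2 ((A @ G True) @ G True @ B) ((A @ G True) @ G False @ B)"
    using one_two_seq_antiparallel_grids[of "A @ G True" ?l Up Down ?l B True] AG B
    by (simp add: G_def)
  moreover have "hopf_cable_diagram = (A @ G True) @ G True @ B"
    by (simp add: hopf_cable_diagram_def hopf_diagram_def antiparallel_cable_def A_def B_def G_def
        cable_level_def)
  moreover have "isotopic ((A @ G True) @ G False @ B) (A @ B)"
    using deform_plug[OF mpass_cancel[of ?l ?l True], of A ?l ?l B] A B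
    by (simp add: G_def grid_eq_mpass)
  moreover have "link_diagram (A @ B)"
    using A B unfolding link_diagram_def tangle_append by blast
  moreover have "\<forall>x \<in> set (A @ B). \<not> is_crossing x"
    by (simp add: A_def B_def cable_level_def)
  ultimately show ?thesis
    unfolding unlink_diagram_def by metis
qed

section \<open>Linking weights of labelled diagrams\<close>

lemma opp_eq_iff: "opp d = e \<longleftrightarrow> e \<noteq> d" "d = opp e \<longleftrightarrow> d \<noteq> e"
  by (cases d; cases e; simp)+

lemma obtain_split3:
  assumes "length y = length (l @ m @ r)"
  obtains x a z where "y = x @ a @ z" "length x = length l" "length a = length m" "length z = length r"
proof
  show "y = take (length l) y @ take (length m) (drop (length l) y) @ drop (length m) (drop (length l) y)"
    by (simp del: drop_drop)
qed (use assms in auto)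

text \<open>
  A symmetric weight of pairs of components.  It vanishes on equal labels because the signed number of
  self-crossings is not an isotopy invariant.
\<close>
locale pair_weight =
  fixes w :: "'c \<Rightarrow> 'c \<Rightarrow> 'g::ab_group_add"
  assumes w_commute: "w x y = w y x"
    and w_same [simp]: "w x x = 0"
begin

text \<open>
  Labels are constant along strands, so both legs of an extremum carry the same label.  A crossing
  is positive iff \<open>p = (d = e)\<close>.
\<close>
fun event_linking :: "event \<Rightarrow> 'c list \<Rightarrow> 'c list \<Rightarrow> 'g \<Rightarrow> bool" where
  "event_linking (Min d) s t k \<longleftrightarrow> s = [] \<and> (\<exists>x. t = [x, x]) \<and> k = 0"
| "event_linking (Max d) s t k \<longleftrightarrow> (\<exists>x. s = [x, x]) \<and> t = [] \<and> k = 0"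
| "event_linking (Cross p d e) s t k \<longleftrightarrow>
     (\<exists>x y. s = [x, y] \<and> t = [y, x] \<and> k = (if p = (d = e) then w x y else - w x y))"

text \<open>
  \<open>linking s D t k\<close> says that \<open>D\<close> has a labelling which reads \<open>s\<close> at the bottom and \<open>t\<close> at the
  top and whose crossings have total weight \<open>k\<close>.  For closed diagrams \<open>k\<close> is twice the sum of the
  linking numbers of the pairs of differently labelled sublinks, each multiplied by its weight.
\<close>
fun linking :: "'c list \<Rightarrow> diagram \<Rightarrow> 'c list \<Rightarrow> 'g \<Rightarrow> bool" where
  "linking s [] t k \<longleftrightarrow> s = t \<and> k = 0"
| "linking s ((l, g, r) # D) t k \<longleftrightarrow>
     (\<exists>x a b z i j. length x = length l \<and> length z = length r \<and> s = x @ a @ z \<and>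
       event_linking g a b i \<and> linking (x @ b @ z) D t j \<and> k = i + j)"

lemma event_linking_length:
  "event_linking g a b i \<Longrightarrow> length a = length (lower g) \<and> length b = length (upper g)"
  by (cases g) auto

lemma linking_slice:
  assumes "length x = length l" "length a = length (lower g)" "length z = length r"
  shows "linking (x @ a @ z) ((l, g, r) # D) t k \<longleftrightarrow>
    (\<exists>b i j. event_linking g a b i \<and> linking (x @ b @ z) D t j \<and> k = i + j)"
proof
  assume "linking (x @ a @ z) ((l, g, r) # D) t k"
  then obtain x' a' b z' i j where *: "length x' = length l" "length z' = length r"
      "x @ a @ z = x' @ a' @ z'" "event_linking g a' b i" "linking (x' @ b @ z') D t j" "k = i + j"
    by auto
  then have "length a' = length a"
    using assms event_linking_length by metis
  then have "x = x'" "a = a'" "z = z'"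
    using * assms by auto
  then show "\<exists>b i j. event_linking g a b i \<and> linking (x @ b @ z) D t j \<and> k = i + j"
    using * by blast
next
  assume "\<exists>b i j. event_linking g a b i \<and> linking (x @ b @ z) D t j \<and> k = i + j"
  then show "linking (x @ a @ z) ((l, g, r) # D) t k"
    unfolding linking.simps using assms by blast
qed

lemma linking_Min:
  assumes "length s = length l + length r"
  shows "linking s ((l, Min d, r) # D) t k \<longleftrightarrow>
    (\<exists>c. linking (take (length l) s @ [c, c] @ drop (length l) s) D t k)"
  using linking_slice[of "take (length l) s" l "[]" "Min d" "drop (length l) s" r D t k] assms
  by auto

lemma linking_Max:
  assumes "length s = length l + length r + 2"
  shows "linking s ((l, Max d, r) # D) t k \<longleftrightarrow>
    s ! length l = s ! Suc (length l) \<and> linking (take (length l) s @ drop (length l + 2) s) D t k"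
proof -
  have "s = take (length l) s @ [s ! length l, s ! Suc (length l)] @ drop (length l + 2) s"
    using assms by (simp add: Cons_nth_drop_Suc)
  then show ?thesis
    using linking_slice[of "take (length l) s" l "[s ! length l, s ! Suc (length l)]" "Max d"
      "drop (length l + 2) s" r D t k] assms by auto
qed

lemma linking_Cross:
  assumes "length s = length l + length r + 2"
  shows "linking s ((l, Cross p d e, r) # D) t k \<longleftrightarrow>
    linking (take (length l) s @ [s ! Suc (length l), s ! length l] @ drop (length l + 2) s) D t
      (k - (if p = (d = e) then w (s ! length l) (s ! Suc (length l))
        else - w (s ! length l) (s ! Suc (length l))))"
proof -
  have "s = take (length l) s @ [s ! length l, s ! Suc (length l)] @ drop (length l + 2) s"
    using assms by (simp add: Cons_nth_drop_Suc)
  then show ?thesis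
    using linking_slice[of "take (length l) s" l "[s ! length l, s ! Suc (length l)]" "Cross p d e"
      "drop (length l + 2) s" r D t k] assms by (auto simp: algebra_simps)
qed

lemma linking_length:
  "linking x u y k \<Longrightarrow> tangle s u t \<Longrightarrow> length x = length s \<Longrightarrow> length y = length t"
proof (induction u arbitrary: x s k)
  case (Cons e u)
  obtain l g r where e: "e = (l, g, r)" by (cases e)
  show ?case
    using Cons.prems Cons.IH[of _ _ "l @ upper g @ r"] by (fastforce simp: e dest: event_linking_length)
qed auto

lemma linking_append:
  "linking x (u @ v) y k \<longleftrightarrow> (\<exists>m i j. linking x u m i \<and> linking m v y j \<and> k = i + j)"
proof (induction u arbitrary: x k)
  case (Cons e u)
  obtain l g r where e: "e = (l, g, r)" by (cases e)
  show ?case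
  proof
    assume "linking x ((e # u) @ v) y k"
    then obtain x' a b z i m i' j' where "length x' = length l" "length z = length r"
        "x = x' @ a @ z" "event_linking g a b i" "linking (x' @ b @ z) u m i'" "linking m v y j'"
        "k = (i + i') + j'"
      by (auto simp: e Cons.IH add.assoc)
    then show "\<exists>m i j. linking x (e # u) m i \<and> linking m v y j \<and> k = i + j"
      unfolding e linking.simps by blast
  next
    assume "\<exists>m i j. linking x (e # u) m i \<and> linking m v y j \<and> k = i + j"
    then obtain x' a b z i m i' j' where "length x' = length l" "length z = length r"
        "x = x' @ a @ z" "event_linking g a b i" "linking (x' @ b @ z) u m i'" "linking m v y j'"
        "k = i + (i' + j')"
      by (auto simp: e add.assoc)
    then show "linking x ((e # u) @ v) y k"
      unfolding e append_Cons linking.simps Cons.IH by blast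
  qed
qed simp

lemma linking_beside:
  assumes "tangle s u t" "length y = length s" "length x = length l" "length z = length r"
  shows "linking (x @ y @ z) (beside l u r) q k \<longleftrightarrow> (\<exists>y'. q = x @ y' @ z \<and> linking y u y' k)"
  using assms
proof (induction u arbitrary: s y k)
  case (Cons e u)
  obtain l' g r' where e: "e = (l', g, r')" by (cases e)
  then have s: "s = l' @ lower g @ r'" and u: "tangle (l' @ upper g @ r') u t"
    using Cons.prems by auto
  obtain x' a z' where y: "y = x' @ a @ z'" "length x' = length l'" "length a = length (lower g)"
    "length z' = length r'"
    using Cons.prems(2) unfolding s by (rule obtain_split3)
  have IH: "linking ((x @ x') @ b @ (z' @ z)) (beside l u r) q j \<longleftrightarrow>
      (\<exists>y'. q = x @ y' @ z \<and> linking (x' @ b @ z') u y' j)" if "event_linking g a b i" for b i j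
    using Cons.IH[OF u, of "x' @ b @ z'" j] event_linking_length[OF that] y Cons.prems by simp
  have "linking (x @ y @ z) (beside l (e # u) r) q k \<longleftrightarrow>
      linking ((x @ x') @ a @ (z' @ z)) ((l @ l', g, r' @ r) # beside l u r) q k"
    by (simp add: e y)
  also have "\<dots> \<longleftrightarrow> (\<exists>b i j. event_linking g a b i \<and>
      linking ((x @ x') @ b @ (z' @ z)) (beside l u r) q j \<and> k = i + j)"
    using y Cons.prems by (intro linking_slice) auto
  also have "\<dots> \<longleftrightarrow> (\<exists>b i j. event_linking g a b i \<and>
      (\<exists>y'. q = x @ y' @ z \<and> linking (x' @ b @ z') u y' j) \<and> k = i + j)"
    using IH by blast
  also have "\<dots> \<longleftrightarrow> (\<exists>y'. q = x @ y' @ z \<and>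
      (\<exists>b i j. event_linking g a b i \<and> linking (x' @ b @ z') u y' j \<and> k = i + j))"
    by blast
  also have "\<dots> \<longleftrightarrow> (\<exists>y'. q = x @ y' @ z \<and> linking y (e # u) y' k)"
    unfolding e y(1) by (simp only: linking_slice[OF y(2-4)])
  finally show ?case .
qed auto

text \<open>
  Every strand on either side of a rule ends at the boundary of the disk, so that the boundary labels
  determine all others.  The crossing of a first Reidemeister move has weight zero, the two crossings
  of a second one have opposite signs, and in all other rules each crossing keeps its sign and its
  two labels.
\<close>
lemma linking_rule:
  assumes "isotopy_rule u v" "tangle s u t" "length x = length s"
  shows "linking x u y k \<longleftrightarrow> linking x v y k"
  using assms(1)
proof
  assume "planar_rule u v"
  then show ?thesis
    using assms(2,3)
  proof cases
    case (exchange g m h)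
    obtain a c a' where x: "x = a @ c @ a'" "length a = length (lower g)" "length c = length m"
      "length a' = length (lower h)"
      using obtain_split3[of x "lower g" m "lower h"] assms exchange by auto
    have "linking (b @ c @ a') [(upper g @ m, h, [])] y j \<longleftrightarrow>
        (\<exists>b'. event_linking h a' b' j \<and> y = b @ c @ b')"
      if "event_linking g a b i" for b i j
      using linking_slice[of "b @ c" "upper g @ m" a' h "[]" "[]" "[]" y j] x event_linking_length[OF that]
      by (auto simp del: linking.simps(2))
    then have 1: "linking x u y k \<longleftrightarrow> (\<exists>b b' i j. event_linking g a b i \<and> event_linking h a' b' j \<and>
        y = b @ c @ b' \<and> k = i + j)"
      using linking_slice[of "[]" "[]" a g "c @ a'" "m @ lower h" "[(upper g @ m, h, [])]" y k] x
      unfolding exchange by (simp del: linking.simps(2)) blast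
    have "linking (a @ c @ b') [([], g, m @ upper h)] y i \<longleftrightarrow>
        (\<exists>b. event_linking g a b i \<and> y = b @ c @ b')"
      if "event_linking h a' b' j" for b' i j
      using linking_slice[of "[]" "[]" a g "c @ b'" "m @ upper h" "[]" y i] x event_linking_length[OF that]
      by (auto simp del: linking.simps(2))
    then have "linking x v y k \<longleftrightarrow> (\<exists>b b' i j. event_linking g a b i \<and> event_linking h a' b' j \<and>
        y = b @ c @ b' \<and> k = j + i)"
      using linking_slice[of "a @ c" "lower g @ m" a' h "[]" "[]" "[([], g, m @ upper h)]" y k] x
      unfolding exchange by (simp del: linking.simps(2)) blast
    with 1 show ?thesis
      by (simp add: add.commute)
  qed (auto simp: length_Suc_conv linking_Min linking_Max linking_Cross opp_eq_iff w_commute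
      simp del: linking.simps(2))
next
  assume "reidemeister_rule u v"
  then show ?thesis
    using assms(2,3)
    by cases (auto simp: length_Suc_conv linking_Min linking_Max linking_Cross opp_eq_iff w_commute
      algebra_simps simp del: linking.simps(2))
qed

lemma linking_plug:
  assumes "tangle [] A (l @ s @ r)" "tangle s u t"
  shows "linking [] (A @ beside l u r @ B) [] k \<longleftrightarrow>
    (\<exists>x y z y' h i j. length x = length l \<and> length y = length s \<and> length z = length r \<and>
      linking [] A (x @ y @ z) h \<and> linking y u y' i \<and> linking (x @ y' @ z) B [] j \<and> k = h + i + j)"
    (is "?L \<longleftrightarrow> ?R")
proof
  assume ?L
  then obtain q q' h i j where *: "linking [] A q h" "linking q (beside l u r) q' i"
      "linking q' B [] j" "k = h + i + j"
    by (auto simp: linking_append algebra_simps)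
  have "length q = length (l @ s @ r)"
    by (rule linking_length[OF *(1) assms(1)]) simp
  then obtain x y z where q: "q = x @ y @ z" "length x = length l" "length y = length s"
      "length z = length r"
    by (rule obtain_split3)
  then obtain y' where "q' = x @ y' @ z" "linking y u y' i"
    using *(2) linking_beside[OF assms(2)] by blast
  then show ?R
    using * q by blast
next
  assume ?R
  then obtain x y z y' h i j where *: "length x = length l" "length y = length s" "length z = length r"
      "linking [] A (x @ y @ z) h" "linking y u y' i" "linking (x @ y' @ z) B [] j" "k = h + (i + j)"
    by (auto simp: add.assoc)
  then have "linking (x @ y @ z) (beside l u r) (x @ y' @ z) i"
    using linking_beside[OF assms(2)] by blast
  then show ?L
    unfolding linking_append using * by blast
qed

lemma linking_isotopic: "isotopic D D' \<Longrightarrow> linking [] D [] k \<longleftrightarrow> linking [] D' [] k"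
  unfolding isotopic_def
proof (induction rule: equivclp_induct)
  case (step D' E)
  have "linking [] D [] k \<longleftrightarrow> linking [] D' [] k" if "local_change isotopy_rule D D'" for D D'
  proof -
    from that isotopy_rule_boundary obtain A B l r u v s t
      where "isotopy_rule u v" "D = A @ beside l u r @ B" "D' = A @ beside l v r @ B"
        "tangle [] A (l @ s @ r)" "tangle s u t" "tangle s v t" "tangle (l @ t @ r) B []"
      by (rule local_change_decompose)
    note D = this
    have "linking y u y' i \<longleftrightarrow> linking y v y' i" if "length y = length s" for y y' i
      using linking_rule[OF D(1,5) that] .
    then show ?thesis
      unfolding D(2,3) linking_plug[OF D(4,5)] linking_plug[OF D(4,6)] by (simp cong: conj_cong)
  qed
  with step show ?case by blast
qed simp

lemma linking_grid:
  "linking [x, y, u, v] (grid p a b c d) q i \<longleftrightarrow> q = [u, v, x, y] \<and>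
     i = (if p = (a = c) then w x u else - w x u) + (if p = (a = d) then w x v else - w x v) +
         (if p = (b = c) then w y u else - w y u) + (if p = (b = d) then w y v else - w y v)"
  by (auto simp: grid_def linking_Cross algebra_simps simp del: linking.simps(2))

text \<open>
  The pair called \<open>x\<close>, \<open>y\<close> is the parallel one, which may be either of the two pairs of the grid;
  the sign of \<open>i\<close> is absorbed in the order of \<open>u\<close> and \<open>v\<close>.
\<close>
lemma linking_one_two_rule:
  assumes "one_two_rule g g'" "tangle s g t" "length q = length s" "linking q g q' i"
  obtains x y u v where "i = w x u + w y u - w x v - w y v" "linking q g' q' (- i)"
  using assms(1)
proof cases
  case (1 a b c d p)
  then have "length q = 4"
    using assms(2,3) by (simp add: grid_def)
  then obtain x y u v where q: "q = [x, y, u, v]"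
    by (auto simp: numeral_eq_Suc length_Suc_conv)
  have "linking q g' q' (- i)"
    using assms(4) unfolding 1 q linking_grid by (auto simp: algebra_simps)
  moreover have "i = w x u + w y u - w x v - w y v \<or> i = w x v + w y v - w x u - w y u \<or>
      i = w u x + w v x - w u y - w v y \<or> i = w u y + w v y - w u x - w v x"
    using assms(4) 1(3) unfolding 1(1) q linking_grid
    by (cases a; cases b; cases c; cases d; cases p) (simp_all add: w_commute)
  ultimately show ?thesis
    using that by metis
qed

lemma linking_one_two_move:
  assumes "one_two_move D D'" "linking [] D [] k"
  obtains x y u v i where "i = w x u + w y u - w x v - w y v" "linking [] D' [] (k - i - i)"
proof -
  have "g \<noteq> [] \<and> (\<exists>s t. tangle s g t \<and> tangle s g' t)" if "one_two_rule g g'" for g g'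
    using that one_two_rule_boundary[OF that] by cases (auto simp: grid_def)
  with assms(1) obtain A B l r g g' s t
    where rule: "one_two_rule g g'" and D: "D = A @ beside l g r @ B" "D' = A @ beside l g' r @ B"
      "tangle [] A (l @ s @ r)" "tangle s g t" "tangle s g' t" "tangle (l @ t @ r) B []"
    by (rule local_change_decompose)
  from assms(2) obtain x' q z' q' h i j where *: "length x' = length l" "length q = length s" "length z' = length r"
      "linking [] A (x' @ q @ z') h" "linking q g q' i" "linking (x' @ q' @ z') B [] j" "k = h + i + j"
    unfolding D(1) linking_plug[OF D(3,4)] by blast
  obtain x y u v where i: "i = w x u + w y u - w x v - w y v" and "linking q g' q' (- i)"
    using linking_one_two_rule[OF rule D(4) *(2,5)] .
  then have "linking [] D' [] (h + (- i) + j)"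
    unfolding D(2) linking_plug[OF D(3,5)] using * by blast
  moreover have "h + (- i) + j = k - i - i"
    using *(7) by (simp add: algebra_simps)
  ultimately show ?thesis
    using that[OF i] by metis
qed

lemma linking_crossingless:
  "linking s U t k \<Longrightarrow> \<forall>x \<in> set U. \<not> is_crossing x \<Longrightarrow> k = 0"
proof (induction U arbitrary: s k)
  case (Cons e U)
  obtain l g r where e: "e = (l, g, r)" by (cases e)
  with Cons show ?case by (cases g) auto
qed simp

lemma linking_unlink: "unlink_diagram D \<Longrightarrow> linking [] D [] k \<Longrightarrow> k = 0"
  unfolding unlink_diagram_def using linking_isotopic linking_crossingless by blast

text \<open>
  The linking numbers \<open>lk(a,c) = lk(b,d) = -1\<close> and \<open>lk(a,d) = lk(b,c) = 1\<close>, each of them counted by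
  two crossings.
\<close>
lemma linking_hopf_cable:
  assumes "k = w a d - w a c + w b c - w b d"
  shows "linking [] hopf_cable_diagram [] (k + k)"
  unfolding hopf_cable_diagram_def hopf_diagram_def antiparallel_cable_def
  apply (simp add: linking_Min linking_Max linking_Cross grid_def cable_level_def
      del: linking.simps(2))
  \<comment> \<open>One label is chosen at each of the four minima, in the order of their heights.\<close>
  apply (rule exI[of _ a], rule exI[of _ b], rule exI[of _ c], rule exI[of _ d])
  using assms by (simp add: w_commute algebra_simps)

end

section \<open>One move does not suffice\<close>

lemma at_least_two_moves:
  assumes "isotopic hopf_cable_diagram D" "unlink_diagram U" "one_two_seq n D U"
  shows "2 \<le> n"
proof (rule ccontr)
  assume n: "\<not> 2 \<le> n"
  \<comment> \<open>The components \<open>a\<close>, \<open>b\<close>, \<open>c\<close>, \<open>d\<close> get the labels 0, 1, 2, 3.  The first coordinate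
    sees the pair \<open>a c\<close>, the second one the disjoint pair \<open>b d\<close>.\<close>
  define w :: "nat \<Rightarrow> nat \<Rightarrow> int \<times> int"
    where "w x y = (if {x, y} = {0, 2} then 1 else 0, if {x, y} = {1, 3} then 1 else 0)" for x y
  interpret pair_weight w
    by standard (auto simp: w_def insert_commute zero_prod_def)
  have "w 0 3 - w 0 2 + w 1 2 - w 1 3 = (- 1, - 1)"
    by (simp add: w_def doubleton_eq_iff)
  then have "linking [] hopf_cable_diagram [] (- 2, - 2)"
    using linking_hopf_cable[of "(- 1, - 1)" 0 3 2 1] by simp
  then have D: "linking [] D [] (- 2, - 2)"
    using linking_isotopic assms(1) by blast
  from assms(3) n show False
  proof cases
    case 1
    then show ?thesis
      using D assms(2) linking_isotopic linking_unlink by (fastforce simp: zero_prod_def)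
  next
    case (2 m E F)
    then have "m = 0" using n by simp
    then have "isotopic D E"
      using 2(2) by (auto elim: one_two_seq.cases)
    then have "linking [] E [] (- 2, - 2)"
      using D linking_isotopic by blast
    from linking_one_two_move[OF 2(3) this] obtain x y u v i
      where i: "i = w x u + w y u - w x v - w y v" and "linking [] F [] ((- 2, - 2) - i - i)" .
    then have "(- 2, - 2) - i - i = 0"
      using 2(4) assms(2) linking_isotopic linking_unlink by blast
    then have "i = (- 1, - 1)"
      by (cases i) (auto simp: zero_prod_def)
    \<comment> \<open>A negative coordinate can only come from a term with \<open>v\<close>, but \<open>v\<close> belongs to at most one
      of the two pairs.\<close>
    with i have "v \<in> {0, 2}" "v \<in> {1, 3}"
      by (auto simp: w_def doubleton_eq_iff split: if_splits)
    then show ?thesis by auto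
  qed
qed

theorem theorem5p1:
  shows "nt (link_of hopf_cable_diagram) = 2"
proof (rule antisym)
  obtain U where "unlink_diagram U" "one_two_seq 2 hopf_cable_diagram U"
    using hopf_cable_two_moves by blast
  then have "nt (link_of hopf_cable_diagram) \<le> enat 2"
    unfolding nt_def link_of_def using isotopic_refl by (blast intro: INF_lower)
  then show "nt (link_of hopf_cable_diagram) \<le> 2"
    by (simp add: numeral_eq_enat)
next
  have "enat 2 \<le> nt (link_of hopf_cable_diagram)"
    unfolding nt_def link_of_def by (rule INF_greatest) (auto dest: at_least_two_moves)
  then show "2 \<le> nt (link_of hopf_cable_diagram)"
    by (simp add: numeral_eq_enat)
qed

end
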